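(* Let $0<r<1$, let $T$ be an invertible bounded operator on a complex Hilbert space, and let $Y\subseteq\mathbb{C}\setminus\{0\}$. Then $Y$ is a von Neumann set for $T$ if and only if $\kappa(Y)$ is a von Neumann set for the commuting pair $\kappa(T)$.
   Context: $\kappa:\mathbb{C}\setminus\{0\}\to\mathbb{C}^2$ is $\kappa(z)=\left(\frac{z}{\sqrt{1+r^2}},\frac{rz^{-1}}{\sqrt{1+r^2}}\right)$, and for an invertible operator $T$, $\kappa(T)=\left(\frac{T}{\sqrt{1+r^2}},\frac{rT^{-1}}{\sqrt{1+r^2}}\right)$. A set $Y\subseteq\mathbb{C}^n$ (not necessarily compact or closed) is a von Neumann set for a commuting $n$-tuple $\underline{T}$ of bounded operators if its Taylor joint spectrum satisfies $\sigma_T(\underline{T})\subseteq Y$ and $\|f(\underline{T})\|\le\|f\|_{\infty,Y}:=\sup_{\xi\in Y}|f(\xi)|$ (allowed to be $+\infty$) for every $f\in Rat(Y)$, where $Rat(Y)$ is the algebra of rational functions $f=p/g$ with $p,g\in\mathbb{C}[z_1,\dots,z_n]$ and $g$ having no zeros in $Y$, and $f(\underline{T})=p(\underline{T})g(\underline{T})^{-1}$. *)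

theory Defs
  imports "HOL-Analysis.Analysis" "HOL-Library.Poly_Mapping"
begin

section \<open>Complex Hilbert spaces\<close>

text \<open>
  The inner product is linear in the first argument. The norm, the metric and the real scalar
  multiplication are those of the superclass, so that completeness and \<^const>\<open>onorm\<close> are
  the ones of the library.
\<close>

class complex_inner = real_normed_vector +
  fixes scaleC :: "complex \<Rightarrow> 'a \<Rightarrow> 'a"  (infixr \<open>*\<^sub>C\<close> 75)
    and cinner :: "'a \<Rightarrow> 'a \<Rightarrow> complex"
  assumes scaleC_add_right: "a *\<^sub>C (x + y) = a *\<^sub>C x + a *\<^sub>C y"
    and scaleC_add_left: "(a + b) *\<^sub>C x = a *\<^sub>C x + b *\<^sub>C x"
    and scaleC_scaleC: "a *\<^sub>C b *\<^sub>C x = (a * b) *\<^sub>C x"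
    and scaleC_of_real: "complex_of_real t *\<^sub>C x = t *\<^sub>R x"
    and cinner_commute: "cinner x y = cnj (cinner y x)"
    and cinner_add_left: "cinner (x + y) z = cinner x z + cinner y z"
    and cinner_scaleC_left: "cinner (a *\<^sub>C x) y = a * cinner x y"
    and cinner_self: "cinner x x = complex_of_real ((norm x)\<^sup>2)"

class chilbert_space = complex_inner + complete_space

instantiation complex :: chilbert_space
begin
definition "scaleC_complex (a :: complex) (x :: complex) = a * x"
definition "cinner_complex (x :: complex) (y :: complex) = x * cnj y"
instance
  by standard
    (simp_all add: scaleC_complex_def cinner_complex_def algebra_simps scaleR_conv_of_real
      complex_norm_square del: of_real_power)
end


section \<open>Bounded operators and commuting tuples\<close>

definition bounded_clinear :: "('a::complex_inner \<Rightarrow> 'a) \<Rightarrow> bool" where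
  "bounded_clinear T \<longleftrightarrow> bounded_linear T \<and> (\<forall>a x. T (a *\<^sub>C x) = a *\<^sub>C T x)"

definition invertible_op :: "('a::complex_inner \<Rightarrow> 'a) \<Rightarrow> bool" where
  "invertible_op T \<longleftrightarrow> bounded_clinear T \<and>
     (\<exists>S. bounded_clinear S \<and> S \<circ> T = id \<and> T \<circ> S = id)"

definition commuting_tuple :: "('n::finite \<Rightarrow> 'a::complex_inner \<Rightarrow> 'a) \<Rightarrow> bool" where
  "commuting_tuple T \<longleftrightarrow>
     (\<forall>i. bounded_clinear (T i)) \<and> (\<forall>i j. T i \<circ> T j = T j \<circ> T i)"


section \<open>Taylor joint spectrum\<close>

text \<open>
  With $n$ the cardinality of the index type, an element of $H \otimes \Lambda(\mathbb{C}^n)$ is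
  given by its coefficients $x_S \in H$ in the basis $e_S = e_{i_1} \wedge \dots \wedge e_{i_k}$,
  where $S = \{i_1 < \dots < i_k\}$. The Koszul differential is
  $D(h \otimes \omega) = \sum_i T_i h \otimes (e_i \wedge \omega)$; the sign below is that of
  $e_i \wedge e_{S - \{i\}}$ relative to $e_S$. As $D$ raises the degree by one, exactness in
  every degree is the same as \<open>ker D = ran D\<close> on the whole space. The order of the index type
  only serves to fix the basis.
\<close>

definition koszul_diff ::
  "('n::{finite,linorder} \<Rightarrow> 'a::complex_inner \<Rightarrow> 'a) \<Rightarrow> ('n set \<Rightarrow> 'a) \<Rightarrow> ('n set \<Rightarrow> 'a)" where
  "koszul_diff T x = (\<lambda>S. \<Sum>i\<in>S. (-1) ^ card {j \<in> S. j < i} *\<^sub>R T i (x (S - {i})))"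

definition koszul_exact :: "('n::{finite,linorder} \<Rightarrow> 'a::complex_inner \<Rightarrow> 'a) \<Rightarrow> bool" where
  "koszul_exact T \<longleftrightarrow> {x. koszul_diff T x = (\<lambda>S. 0)} = range (koszul_diff T)"

definition taylor_spectrum ::
  "('n::{finite,linorder} \<Rightarrow> 'a::complex_inner \<Rightarrow> 'a) \<Rightarrow> (complex ^ 'n::{finite,linorder}) set" where
  "taylor_spectrum T = {w. \<not> koszul_exact (\<lambda>i x. T i x - (w $ i) *\<^sub>C x)}"


section \<open>Polynomials in several variables and their functional calculus\<close>

text \<open>Polynomials map exponent vectors, of type \<open>'n \<Rightarrow>\<^sub>0 nat\<close>, to coefficients.\<close>

definition mpoly_eval :: "(('n \<Rightarrow>\<^sub>0 nat) \<Rightarrow>\<^sub>0 complex) \<Rightarrow> complex ^ 'n::finite \<Rightarrow> complex" where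
  "mpoly_eval p z =
     (\<Sum>m\<in>Poly_Mapping.keys p.
        Poly_Mapping.lookup p m * (\<Prod>i\<in>UNIV. (z $ i) ^ Poly_Mapping.lookup m i))"

definition monomial_op ::
  "('n::{finite,linorder} \<Rightarrow>\<^sub>0 nat) \<Rightarrow> ('n \<Rightarrow> 'a \<Rightarrow> 'a) \<Rightarrow> 'a \<Rightarrow> 'a" where
  "monomial_op m T =
     foldr (\<lambda>i F. (T i ^^ Poly_Mapping.lookup m i) \<circ> F) (sorted_list_of_set UNIV) id"

definition mpoly_op ::
  "(('n::{finite,linorder} \<Rightarrow>\<^sub>0 nat) \<Rightarrow>\<^sub>0 complex) \<Rightarrow> ('n \<Rightarrow> 'a::complex_inner \<Rightarrow> 'a) \<Rightarrow> 'a \<Rightarrow> 'a" where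
  "mpoly_op p T =
     (\<lambda>x. \<Sum>m\<in>Poly_Mapping.keys p. Poly_Mapping.lookup p m *\<^sub>C monomial_op m T x)"


section \<open>Von Neumann sets\<close>

text \<open>
  A rational function is given by numerator and denominator; \<open>g \<noteq> 0\<close> only matters for
  \<open>Y = {}\<close>.
\<close>

definition Rat :: "(complex ^ 'n::finite) set \<Rightarrow>
    ((('n \<Rightarrow>\<^sub>0 nat) \<Rightarrow>\<^sub>0 complex) \<times> (('n \<Rightarrow>\<^sub>0 nat) \<Rightarrow>\<^sub>0 complex)) set" where
  "Rat Y = {(p, g). g \<noteq> 0 \<and> (\<forall>z\<in>Y. mpoly_eval g z \<noteq> 0)}"

text \<open>
  Used only when the Taylor spectrum of \<open>T\<close> avoids the zeros of \<open>g\<close>. Then \<open>mpoly_op g T\<close> is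
  bijective, by spectral mapping, and \<^const>\<open>inv\<close> is its two-sided inverse.
\<close>

definition rat_op ::
  "(('n::{finite,linorder} \<Rightarrow>\<^sub>0 nat) \<Rightarrow>\<^sub>0 complex) \<Rightarrow> (('n \<Rightarrow>\<^sub>0 nat) \<Rightarrow>\<^sub>0 complex) \<Rightarrow>
    ('n \<Rightarrow> 'a::complex_inner \<Rightarrow> 'a) \<Rightarrow> 'a \<Rightarrow> 'a" where
  "rat_op p g T = mpoly_op p T \<circ> inv (mpoly_op g T)"

text \<open>The supremum is taken in $[0, \infty]$.\<close>

definition von_neumann_set ::
  "(complex ^ 'n::{finite,linorder}) set \<Rightarrow> ('n \<Rightarrow> 'a::chilbert_space \<Rightarrow> 'a) \<Rightarrow> bool" where
  "von_neumann_set Y T \<longleftrightarrow>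
     commuting_tuple T \<and> taylor_spectrum T \<subseteq> Y \<and>
     (\<forall>(p, g)\<in>Rat Y.
        ennreal (onorm (rat_op p g T)) \<le>
          (SUP z\<in>Y. ennreal (cmod (mpoly_eval p z / mpoly_eval g z))))"


section \<open>The map kappa\<close>

definition kappa :: "real \<Rightarrow> complex \<Rightarrow> complex ^ 2" where
  "kappa r z = vector [z / of_real (sqrt (1 + r\<^sup>2)), of_real r * inverse z / of_real (sqrt (1 + r\<^sup>2))]"

definition kappa_op :: "real \<Rightarrow> ('a::complex_inner \<Rightarrow> 'a) \<Rightarrow> 2 \<Rightarrow> 'a \<Rightarrow> 'a" where
  "kappa_op r T = (\<lambda>i x. if i = 1 then T x /\<^sub>R sqrt (1 + r\<^sup>2)
                         else (r *\<^sub>R inv T x) /\<^sub>R sqrt (1 + r\<^sup>2))"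

end

theory Submission
  imports Defs "HOL-Computational_Algebra.Fundamental_Theorem_Algebra"
begin

text \<open>
  Since the coordinates of $\kappa(z)$ are multiples of $z$ and $z^{-1}$, composition with $\kappa$
  turns a polynomial in two variables into a Laurent polynomial in $z$, and multiplying numerator
  and denominator by the same power of $z$, which has no zeros on $Y$, gives an element of
  $Rat(Y)$. Conversely, a polynomial in $z$ is a polynomial in the first coordinate of
  $\kappa(z)$. Both translations respect the functional calculus, provided that the denominator
  is bijective at $T$; this follows by splitting it into linear factors.

  The spectra correspond as well. With $s = \sqrt{1 + r^2}$ and $w_1 w_2 \neq r / s^2$, the relation
  $A B = r / s^2$ for $(A, B) = \kappa(T)$ writes a nonzero multiple of the identity as a
  combination of $A - w_1$ and $B - w_2$, so the Koszul complex is exact. If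
  $w_1 w_2 = r / s^2$, then $w = \kappa(z)$ for some $z \neq 0$, and $B - w_2$ is a multiple of
  $A - w_1$ by an operator commuting with it, so exactness means that $A - w_1$, equivalently $T - z$,
  is bijective.
\<close>


section \<open>Complex-linear operators\<close>

interpretation cvs: vector_space "scaleC :: complex \<Rightarrow> 'a::complex_inner \<Rightarrow> 'a"
  by unfold_locales (simp_all add: scaleC_add_right scaleC_add_left scaleC_scaleC scaleC_of_real [of 1, simplified])

lemma scaleR_scaleC: "t *\<^sub>R x = complex_of_real t *\<^sub>C (x :: 'a::complex_inner)"
  by (simp add: scaleC_of_real)

lemma bounded_clinear_linear: "bounded_clinear T \<Longrightarrow> linear T"
  by (simp add: bounded_clinear_def bounded_linear.linear)

lemma bounded_clinear_scaleC: "bounded_clinear T \<Longrightarrow> T (a *\<^sub>C x) = a *\<^sub>C T x"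
  by (simp add: bounded_clinear_def)

lemma bounded_clinear_diff_scaleC:
  assumes "bounded_clinear T" shows "linear (\<lambda>x. T x - w *\<^sub>C x)"
  using bounded_clinear_linear[OF assms]
  by (auto intro!: linearI simp: linear_add linear_scale scaleR_scaleC cvs.scale_right_distrib
      bounded_clinear_scaleC[OF assms] cvs.scale_right_diff_distrib mult.commute)

lemma bounded_clinear_scaleC_left:
  assumes "bounded_clinear T" shows "bounded_clinear (\<lambda>x. c *\<^sub>C T x)"
proof -
  \<comment> \<open>The class axioms link the norm to scalars only for real ones; the complex case
    is recovered from the inner product through \<open>cinner_self\<close>.\<close>
  have norm: "norm (c *\<^sub>C x) = cmod c * norm x" for x :: 'a
  proof -
    have "complex_of_real ((norm (c *\<^sub>C x))\<^sup>2) = c * cnj (c * cinner x x)"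
      by (metis cinner_self cinner_scaleC_left cinner_commute)
    also have "\<dots> = complex_of_real ((cmod c * norm x)\<^sup>2)"
      by (simp add: cinner_self power_mult_distrib mult.assoc[symmetric] complex_norm_square
          del: of_real_power)
    finally show ?thesis
      by (metis norm_ge_zero mult_nonneg_nonneg of_real_eq_iff power2_eq_iff_nonneg)
  qed
  obtain K where K: "norm (T x) \<le> norm x * K" for x
    using assms bounded_linear.bounded unfolding bounded_clinear_def by blast
  have "bounded_linear (\<lambda>x. c *\<^sub>C T x)"
  proof (rule bounded_linear_intro)
    show "norm (c *\<^sub>C T x) \<le> norm x * (cmod c * K)" for x
      using mult_left_mono[OF K, of "cmod c" x] by (simp add: norm mult_ac)
  qed (simp_all add: linear_add[OF bounded_clinear_linear[OF assms]] scaleR_scaleC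
      bounded_clinear_scaleC[OF assms] cvs.scale_right_distrib mult.commute)
  then show ?thesis
    by (simp add: bounded_clinear_def bounded_clinear_scaleC[OF assms] mult.commute)
qed

lemma bij_scaleC_iff:
  fixes f :: "'b \<Rightarrow> 'a::complex_inner"
  assumes "c \<noteq> 0" shows "bij (\<lambda>x. c *\<^sub>C f x) \<longleftrightarrow> bij f"
proof -
  have *: "bij (\<lambda>x :: 'a. a *\<^sub>C x)" if "a \<noteq> 0" for a
    by (rule o_bij[where g = "\<lambda>x. inverse a *\<^sub>C x"]) (use that in auto)
  show ?thesis
  proof
    assume "bij (\<lambda>x. c *\<^sub>C f x)"
    from bij_comp[OF this *[of "inverse c"]] show "bij f" using assms by (simp add: o_def)
  next
    assume "bij f"
    from bij_comp[OF this *[OF assms]] show "bij (\<lambda>x. c *\<^sub>C f x)" by (simp add: o_def)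
  qed
qed

text \<open>Two-sided inverses are unique, so the bounded inverse supplied by
  \<open>invertible_op\<close> is the function \<open>inv T\<close> that occurs in
  \<open>kappa_op\<close>.\<close>

lemma invertible_op_inv:
  assumes "invertible_op T"
  shows "bounded_clinear T" "bounded_clinear (inv T)" "T (inv T x) = x" "inv T (T x) = x" "bij T"
proof -
  obtain S where S: "bounded_clinear S" "S \<circ> T = id" "T \<circ> S = id"
    using assms by (auto simp: invertible_op_def)
  then have "inv T = S" by (metis inv_unique_comp)
  with S show "bounded_clinear (inv T)" "T (inv T x) = x" "inv T (T x) = x"
    by (metis comp_apply id_apply)+
  show "bij T" using S by (metis o_bij)
qed (use assms in \<open>simp add: invertible_op_def\<close>)

lemma funpow_scaleC:
  assumes "bounded_clinear T"
  shows "((\<lambda>x. c *\<^sub>C T x) ^^ n) x = c ^ n *\<^sub>C (T ^^ n) x"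
  by (induction n) (simp_all add: bounded_clinear_scaleC[OF assms])


section \<open>Koszul exactness for one and two operators\<close>

lemma set_num1_cases: "S = {} \<or> S = {1 :: 1}"
proof -
  have "S \<subseteq> {1 :: 1}" by (auto intro: num1_eq1)
  then show ?thesis by (rule subset_singletonD)
qed

lemma koszul_diff_num1:
  "koszul_diff T x = (\<lambda>S. if S = {} then 0 else T (1::1) (x {}))"
proof
  fix S :: "1 set"
  have "j < 1 \<longleftrightarrow> False" for j :: 1 by (metis num1_eq1 less_irrefl)
  then show "koszul_diff T x S = (if S = {} then 0 else T (1::1) (x {}))"
    using set_num1_cases[of S] by (elim disjE) (simp_all only: koszul_diff_def, simp_all)
qed

text \<open>The complex consists of the one map \<open>T 1\<close> from degree 0 to degree 1:
  exactness in degree 0 is injectivity, in degree 1 surjectivity.\<close>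

lemma koszul_exact_num1:
  fixes T :: "1 \<Rightarrow> 'a::complex_inner \<Rightarrow> 'a"
  assumes "linear (T 1)"
  shows "koszul_exact T \<longleftrightarrow> bij (T 1)"
proof
  assume ex: "koszul_exact T"
  show "bij (T 1)"
  proof (rule bijI)
    show "inj (T 1)"
      unfolding linear_injective_0[OF assms]
    proof (intro allI impI)
      fix h assume "T 1 h = 0"
      then have "koszul_diff T (\<lambda>S. if S = {} then h else 0) = (\<lambda>S. 0)"
        by (auto simp: koszul_diff_num1)
      then obtain y where "(\<lambda>S. if S = {} then h else 0) = koszul_diff T y"
        using ex by (auto simp: koszul_exact_def)
      from fun_cong[OF this, of "{}"] show "h = 0" by (simp add: koszul_diff_num1)
    qed
    show "surj (T 1)"
      unfolding surj_def
    proof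
      fix h
      have "koszul_diff T (\<lambda>S. if S = {} then 0 else h) = (\<lambda>S. 0)"
        using linear_0[OF assms] by (auto simp: koszul_diff_num1)
      then obtain y where "(\<lambda>S. if S = {} then 0 else h) = koszul_diff T y"
        using ex by (auto simp: koszul_exact_def)
      from fun_cong[OF this, of "{1}"] show "\<exists>x. h = T 1 x" by (auto simp: koszul_diff_num1)
    qed
  qed
next
  assume b: "bij (T 1)"
  show "koszul_exact T"
    unfolding koszul_exact_def
  proof (intro equalityI subsetI)
    fix x assume "x \<in> {x. koszul_diff T x = (\<lambda>S. 0)}"
    then have "koszul_diff T x {1} = 0" by simp
    then have "T 1 (x {}) = 0" by (simp add: koszul_diff_num1)
    then have x0: "x {} = 0"
      using b linear_injective_0[OF assms] by (auto simp: bij_def)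
    obtain h where h: "T 1 h = x {1}" using b by (metis bij_pointE)
    have "x = koszul_diff T (\<lambda>_. h)"
    proof
      fix S show "x S = koszul_diff T (\<lambda>_. h) S"
        using set_num1_cases[of S] x0 h by (auto simp: koszul_diff_num1)
    qed
    then show "x \<in> range (koszul_diff T)" by simp
  qed (use linear_0[OF assms] in \<open>auto simp: koszul_diff_num1\<close>)
qed

section \<open>The Koszul complex of a pair\<close>

lemma set_2_cases: "S = {} \<or> S = {1} \<or> S = {2} \<or> S = (UNIV :: 2 set)"
proof -
  have "S \<in> Pow {1, 2}" using UNIV_2 by auto
  then show ?thesis unfolding UNIV_2 Pow_insert Pow_empty by blast
qed

text \<open>The numeral 2 is 0 in this type, so the second index precedes the first. This decides
  the sign in top degree and the order of the factors in \<open>monomial_op\<close>.\<close>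

lemma two_less_one: "(2 :: 2) < 1"
proof -
  have "(2::2) = 0" by simp
  show ?thesis unfolding \<open>2 = 0\<close> by (simp add: less_bit0_def bit0.Rep_0 bit0.Rep_1)
qed

lemma koszul_diff_2:
  "koszul_diff T x {} = 0" "koszul_diff T x {1} = T 1 (x {})" "koszul_diff T x {2} = T 2 (x {})"
  "koszul_diff T x (UNIV :: 2 set) = T 2 (x {1}) - T 1 (x {2})"
proof -
  have "UNIV - {2::2} = {1}" "UNIV - {1::2} = {2}" by (auto simp: UNIV_2)
  moreover have "{j :: 2. j < 1} = {2}" "{j :: 2. j < 2} = {}"
    using two_less_one by (auto, (metis exhaust_2 less_irrefl less_asym)+)
  ultimately show "koszul_diff T x (UNIV :: 2 set) = T 2 (x {1}) - T 1 (x {2})"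
    using two_less_one by (simp add: koszul_diff_def) (simp add: UNIV_2)
  have *: "{j. j = i \<and> j < i} = {}" for i :: 2 by auto
  show "koszul_diff T x {1} = T 1 (x {})" "koszul_diff T x {2} = T 2 (x {})"
    by (simp_all add: koszul_diff_def *)
qed (simp add: koszul_diff_def)

lemma koszul_diff_2_eq_iff:
  fixes y :: "2 set \<Rightarrow> 'a::complex_inner"
  shows "koszul_diff T x = y \<longleftrightarrow> y {} = 0 \<and> y {1} = T 1 (x {}) \<and> y {2} = T 2 (x {})
    \<and> y UNIV = T 2 (x {1}) - T 1 (x {2})"
proof
  assume R: "y {} = 0 \<and> y {1} = T 1 (x {}) \<and> y {2} = T 2 (x {})
    \<and> y UNIV = T 2 (x {1}) - T 1 (x {2})"
  show "koszul_diff T x = y"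
  proof
    fix S show "koszul_diff T x S = y S"
      using set_2_cases[of S] R by (elim disjE) (simp_all only: koszul_diff_2)
  qed
qed (auto simp: koszul_diff_2)

text \<open>These are the two ends of the complex, tested on elements concentrated in one degree:
  degree 0 gives a trivial joint kernel, degree 2 gives that the two ranges together span the
  space.\<close>

lemma koszul_exact_2_imp:
  fixes T :: "2 \<Rightarrow> 'a::complex_inner \<Rightarrow> 'a"
  assumes ex: "koszul_exact T" and lin: "\<And>i. linear (T i)"
  shows "T 1 h = 0 \<Longrightarrow> T 2 h = 0 \<Longrightarrow> h = 0" and "\<exists>a b. y = T 2 b - T 1 a"
proof -
  note l0 = linear_0[OF lin]
  assume "T 1 h = 0" "T 2 h = 0"
  then have "koszul_diff T (\<lambda>S. if S = {} then h else 0) = (\<lambda>S. 0)"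
    by (simp add: koszul_diff_2_eq_iff l0)
  then have "(\<lambda>S. if S = {} then h else 0) \<in> range (koszul_diff T)"
    using ex by (auto simp: koszul_exact_def)
  then obtain z where "koszul_diff T z = (\<lambda>S. if S = {} then h else 0)" by (elim rangeE) simp
  then show "h = 0" by (simp add: koszul_diff_2_eq_iff)
next
  have 1: "{1::2} \<noteq> UNIV" "{2::2} \<noteq> UNIV" by (auto simp: UNIV_2)
  note l0 = linear_0[OF lin]
  have "koszul_diff T (\<lambda>S. if S = UNIV then y else 0) = (\<lambda>S. 0)"
    by (simp add: koszul_diff_2_eq_iff l0 1)
  then have "(\<lambda>S. if S = UNIV then y else 0) \<in> range (koszul_diff T)"
    using ex by (auto simp: koszul_exact_def)
  then obtain z where "koszul_diff T z = (\<lambda>S. if S = UNIV then y else 0)" by (elim rangeE) simp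
  then show "\<exists>a b. y = T 2 b - T 1 a" by (auto simp: koszul_diff_2_eq_iff)
qed

text \<open>The operators \<open>U 1\<close> and \<open>U 2\<close> define a contracting homotopy,
  since they commute with the pair and combine with it to the identity.\<close>

lemma koszul_exact_2I:
  fixes T U :: "2 \<Rightarrow> 'a::complex_inner \<Rightarrow> 'a"
  assumes T: "\<And>i. linear (T i)" and U: "\<And>i. linear (U i)"
    and TT: "\<And>x. T 1 (T 2 x) = T 2 (T 1 x)"
    and UT: "\<And>i j x. U i (T j x) = T j (U i x)"
    and one: "\<And>x. U 1 (T 1 x) + U 2 (T 2 x) = x"
  shows "koszul_exact T"
  unfolding koszul_exact_def
proof (intro equalityI subsetI)
  fix x assume "x \<in> range (koszul_diff T)"
  then show "x \<in> {x. koszul_diff T x = (\<lambda>S. 0)}"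
    by (auto simp: koszul_diff_2_eq_iff koszul_diff_2 linear_0[OF T] TT)
next
  fix x assume "x \<in> {x. koszul_diff T x = (\<lambda>S. 0)}"
  then have x: "T 1 (x {}) = 0" "T 2 (x {}) = 0" "T 2 (x {1}) = T 1 (x {2})"
    by (auto simp: koszul_diff_2_eq_iff)
  \<comment> \<open>This is the homotopy applied to \<open>x\<close>. The minus sign at
    \<open>{2}\<close> matches the one in the top coefficient
    \<open>T 2 (x {1}) - T 1 (x {2})\<close>.\<close>
  define y :: "2 set \<Rightarrow> 'a" where "y S = (if S = {} then U 1 (x {1}) + U 2 (x {2})
    else if S = {1} then U 2 (x UNIV) else - U 1 (x UNIV))" for S
  have "x {} = 0" using one[of "x {}"] by (simp add: x linear_0[OF U])
  moreover have "T 1 (y {}) = x {1}"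
    using one[of "x {1}"] by (simp add: y_def linear_add[OF T] x flip: UT)
  moreover have "T 2 (y {}) = x {2}"
    using one[of "x {2}"] by (simp add: y_def linear_add[OF T] x flip: UT)
  moreover have "T 2 (y {1}) - T 1 (y {2}) = x UNIV"
    using one[of "x UNIV"] by (simp add: y_def linear_neg[OF T] add.commute flip: UT)
  ultimately have "koszul_diff T y = x" by (simp add: koszul_diff_2_eq_iff)
  then show "x \<in> range (koszul_diff T)" by blast
qed


section \<open>Polynomials in several variables\<close>

text \<open>Coefficients may cancel in a sum, so \<open>keys (p + q)\<close> can be small; a larger
  index set lets \<open>p\<close>, \<open>q\<close> and \<open>p + q\<close> be summed over the same
  monomials.\<close>

lemma mpoly_eval_superset:
  assumes "finite K" "Poly_Mapping.keys p \<subseteq> K"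
  shows "mpoly_eval p z = (\<Sum>m\<in>K. Poly_Mapping.lookup p m * (\<Prod>i\<in>UNIV. (z $ i) ^ Poly_Mapping.lookup m i))"
  unfolding mpoly_eval_def
  by (rule sum.mono_neutral_left) (use assms in \<open>auto simp: in_keys_iff\<close>)

lemma mpoly_op_superset:
  assumes "finite K" "Poly_Mapping.keys p \<subseteq> K"
  shows "mpoly_op p T x = (\<Sum>m\<in>K. Poly_Mapping.lookup p m *\<^sub>C monomial_op m T x)"
  unfolding mpoly_op_def
  by (rule sum.mono_neutral_left) (use assms in \<open>auto simp: in_keys_iff\<close>)

lemma mpoly_eval_add: "mpoly_eval (p + q) z = mpoly_eval p z + mpoly_eval q z"
proof -
  let ?K = "Poly_Mapping.keys p \<union> Poly_Mapping.keys q"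
  have "Poly_Mapping.keys (p + q) \<subseteq> ?K" by (rule keys_add)
  then show ?thesis
    by (simp add: mpoly_eval_superset[where K = ?K] lookup_add ring_distribs sum.distrib)
qed

lemma mpoly_op_add: "mpoly_op (p + q) T x = mpoly_op p T x + mpoly_op q T x"
proof -
  let ?K = "Poly_Mapping.keys p \<union> Poly_Mapping.keys q"
  have "Poly_Mapping.keys (p + q) \<subseteq> ?K" by (rule keys_add)
  then show ?thesis
    by (simp add: mpoly_op_superset[where K = ?K] lookup_add cvs.scale_left_distrib sum.distrib)
qed

lemma mpoly_eval_sum_single:
  "mpoly_eval (\<Sum>i\<in>I. Poly_Mapping.single (e i) (c i)) z =
    (\<Sum>i\<in>I. c i * (\<Prod>j\<in>UNIV. (z $ j) ^ Poly_Mapping.lookup (e i) j))"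
proof (induction I rule: infinite_finite_induct)
  case (insert i I)
  have "mpoly_eval (Poly_Mapping.single (e i) (c i)) z =
      c i * (\<Prod>j\<in>UNIV. (z $ j) ^ Poly_Mapping.lookup (e i) j)"
    by (simp add: mpoly_eval_superset[where K = "{e i}"])
  then show ?case using insert by (simp add: mpoly_eval_add)
qed (simp_all add: mpoly_eval_def)

lemma mpoly_op_sum_single:
  "mpoly_op (\<Sum>i\<in>I. Poly_Mapping.single (e i) (c i)) T x =
    (\<Sum>i\<in>I. c i *\<^sub>C monomial_op (e i) T x)"
proof (induction I rule: infinite_finite_induct)
  case (insert i I)
  have "mpoly_op (Poly_Mapping.single (e i) (c i)) T x = c i *\<^sub>C monomial_op (e i) T x"
    by (simp add: mpoly_op_superset[where K = "{e i}"])
  then show ?case using insert by (simp add: mpoly_op_add)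
qed (simp_all add: mpoly_op_def)

lemma monomial_op_single: "monomial_op (Poly_Mapping.single k n) T = T k ^^ n"
proof -
  have "distinct xs \<Longrightarrow> foldr (\<lambda>i F. (T i ^^ Poly_Mapping.lookup (Poly_Mapping.single k n) i) \<circ> F) xs id =
      (if k \<in> set xs then T k ^^ n else id)" for xs
    by (induction xs) (auto simp: lookup_single when_def)
  then show ?thesis by (simp add: monomial_op_def)
qed

lemma monomial_op_num1: "monomial_op m (\<lambda>_::1. T) = T ^^ Poly_Mapping.lookup m 1"
proof -
  have "sorted_list_of_set (set [1 :: 1]) = [1]"
    by (rule sorted_list_of_set.idem_if_sorted_distinct) simp_all
  then have "sorted_list_of_set (UNIV :: 1 set) = [1]"
    by (simp only: UNIV_1 list.set)
  then show ?thesis by (simp add: monomial_op_def)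
qed

lemma monomial_op_2:
  "monomial_op m T = (T (2::2) ^^ Poly_Mapping.lookup m 2) \<circ> (T 1 ^^ Poly_Mapping.lookup m 1)"
proof -
  have "{2, 1} = (UNIV :: 2 set)" by (auto simp: UNIV_2)
  then have "sorted_list_of_set (UNIV :: 2 set) = [2, 1]"
    using sorted_list_of_set.idem_if_sorted_distinct[of "[2, 1 :: 2]"] two_less_one by simp
  then show ?thesis by (simp add: monomial_op_def)
qed


section \<open>Polynomials of one operator\<close>

text \<open>Horner's scheme is used because it recurses along \<open>pCons\<close>, so that the laws
  of the calculus follow by induction on polynomials.\<close>

definition poly_op :: "complex poly \<Rightarrow> ('a::complex_inner \<Rightarrow> 'a) \<Rightarrow> 'a \<Rightarrow> 'a" where
  "poly_op p T = fold_coeffs (\<lambda>a F x. a *\<^sub>C x + T (F x)) p (\<lambda>_. 0)"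

context
  fixes T :: "'a::complex_inner \<Rightarrow> 'a"
  assumes T: "bounded_clinear T"
begin

lemma poly_op_0: "poly_op 0 T x = 0"
  by (simp add: poly_op_def)

lemma poly_op_pCons: "poly_op (pCons a p) T x = a *\<^sub>C x + T (poly_op p T x)"
  \<comment> \<open>For \<open>pCons 0 0\<close> the fold performs no step, and the equation holds
    because T maps 0 to 0.\<close>
  using linear_0[OF bounded_clinear_linear[OF T]]
  by (cases "p = 0 \<and> a = 0") (auto simp: poly_op_def)

lemma poly_op_add: "poly_op (p + q) T x = poly_op p T x + poly_op q T x"
  by (induction p q rule: poly_induct2)
    (simp_all add: poly_op_0 poly_op_pCons linear_add[OF bounded_clinear_linear[OF T]]
      cvs.scale_left_distrib algebra_simps)

lemma poly_op_sum: "poly_op (\<Sum>i\<in>I. p i) T x = (\<Sum>i\<in>I. poly_op (p i) T x)"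
  by (induction I rule: infinite_finite_induct) (simp_all add: poly_op_0 poly_op_add)

lemma poly_op_smult: "poly_op (smult c p) T x = c *\<^sub>C poly_op p T x"
  by (induction p) (simp_all add: poly_op_0 poly_op_pCons bounded_clinear_scaleC[OF T]
      cvs.scale_right_distrib)

lemma poly_op_mult: "poly_op (p * q) T x = poly_op p T (poly_op q T x)"
  by (induction p) (simp_all add: poly_op_0 poly_op_pCons poly_op_add poly_op_smult)

lemma poly_op_monom: "poly_op (monom c n) T x = c *\<^sub>C (T ^^ n) x"
  by (induction n) (simp_all add: monom_0 monom_Suc poly_op_0 poly_op_pCons
      linear_0[OF bounded_clinear_linear[OF T]] bounded_clinear_scaleC[OF T])

lemma poly_op_altdef: "poly_op p T x = (\<Sum>i\<le>degree p. coeff p i *\<^sub>C (T ^^ i) x)"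
  using poly_op_sum[of "\<lambda>i. monom (coeff p i) i" "{..degree p}"]
  by (simp add: poly_as_sum_of_monoms poly_op_monom)

text \<open>Induction on the degree: a root \<open>z\<close> of \<open>p\<close> splits off the
  factor T - z, which is bijective by hypothesis, and the roots of the quotient are again roots of
  \<open>p\<close>. It turns \<open>inv\<close> in \<open>rat_op\<close> into a genuine
  inverse.\<close>

lemma bij_poly_op:
  assumes "p \<noteq> 0" and "\<And>z. poly p z = 0 \<Longrightarrow> bij (\<lambda>x. T x - z *\<^sub>C x)"
  shows "bij (poly_op p T)"
  using assms
proof (induction "degree p" arbitrary: p)
  case 0
  then obtain c where p: "p = [:c:]" "c \<noteq> 0" by (metis degree_eq_zeroE pCons_0_0)
  then have "poly_op p T x = c *\<^sub>C x" for x
    by (simp add: poly_op_pCons poly_op_0 linear_0[OF bounded_clinear_linear[OF T]])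
  moreover have "bij (\<lambda>x :: 'a. c *\<^sub>C x)"
    using p bij_scaleC_iff[of c id] by simp
  ultimately show ?case by (metis ext)
next
  case (Suc n)
  then obtain z where z: "poly p z = 0"
    using fundamental_theorem_of_algebra[of p] by (metis constant_degree nat.distinct(1))
  then obtain q where q: "p = [:-z, 1:] * q" by (metis dvdE poly_eq_0_iff_dvd)
  with Suc have "q \<noteq> 0" by auto
  with q Suc.hyps(2) have "n = degree q" by (simp add: degree_mult_eq del: mult_pCons_left)
  then have "bij (poly_op q T)"
    using Suc \<open>q \<noteq> 0\<close> q by simp
  moreover have "poly_op p T = (\<lambda>x. T x - z *\<^sub>C x) \<circ> poly_op q T"
    by (rule ext) (simp add: q poly_op_mult poly_op_pCons poly_op_0
        linear_0[OF bounded_clinear_linear[OF T]] del: mult_pCons_left)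
  ultimately show ?case using Suc.prems(2)[OF z] by (simp add: bij_comp)
qed

end

section \<open>Passage between univariate and multivariate polynomials\<close>

definition to_poly :: "((1 \<Rightarrow>\<^sub>0 nat) \<Rightarrow>\<^sub>0 complex) \<Rightarrow> complex poly" where
  "to_poly p = (\<Sum>m\<in>Poly_Mapping.keys p. monom (Poly_Mapping.lookup p m) (Poly_Mapping.lookup m 1))"

lemma poly_to_poly: "poly (to_poly p) z = mpoly_eval p (vec z)"
  by (simp add: to_poly_def mpoly_eval_def poly_sum poly_monom UNIV_1)

lemma poly_op_to_poly:
  assumes "bounded_clinear T" shows "poly_op (to_poly p) T = mpoly_op p (\<lambda>_. T)"
  by (rule ext) (simp add: to_poly_def mpoly_op_def poly_op_sum[OF assms] poly_op_monom[OF assms]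
      monomial_op_num1)

text \<open>This is the polynomial q(s z_k). With \<open>s = 1\<close> it only changes the type;
  with \<open>s = kappa_scale r\<close> and \<open>k = 1\<close> it recovers q(z) from the first
  coordinate of \<kappa>(z).\<close>

definition of_poly :: "'n \<Rightarrow> complex \<Rightarrow> complex poly \<Rightarrow> ('n \<Rightarrow>\<^sub>0 nat) \<Rightarrow>\<^sub>0 complex" where
  "of_poly k s q = (\<Sum>i\<le>degree q. Poly_Mapping.single (Poly_Mapping.single k i) (coeff q i * s ^ i))"

lemma mpoly_eval_of_poly: "mpoly_eval (of_poly k s q) z = poly q (s * z $ k)"
proof -
  have "(\<Prod>j\<in>UNIV. (z $ j) ^ Poly_Mapping.lookup (Poly_Mapping.single k i) j) = (z $ k) ^ i" for i
  proof -
    have "(\<Prod>j\<in>UNIV. (z $ j) ^ Poly_Mapping.lookup (Poly_Mapping.single k i) j)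
        = (\<Prod>j\<in>UNIV. if j = k then (z $ j) ^ i else 1)"
      by (intro prod.cong) (auto simp: lookup_single when_def)
    then show ?thesis by simp
  qed
  then show ?thesis
    by (simp add: of_poly_def mpoly_eval_sum_single poly_altdef power_mult_distrib mult.assoc)
qed

lemma mpoly_op_of_poly:
  assumes "bounded_clinear (A k)" and "bounded_clinear (\<lambda>x. s *\<^sub>C A k x)"
  shows "mpoly_op (of_poly k s q) A = poly_op q (\<lambda>x. s *\<^sub>C A k x)"
  by (rule ext) (simp add: poly_op_altdef[OF assms(2)] of_poly_def mpoly_op_sum_single
      monomial_op_single funpow_scaleC[OF assms(1)])


section \<open>The spectra of $T$ and $\kappa(T)$\<close>

lemma taylor_spectrum_num1:
  assumes "bounded_clinear T"
  shows "w \<in> taylor_spectrum (\<lambda>_::1. T) \<longleftrightarrow> \<not> bij (\<lambda>x. T x - w $ 1 *\<^sub>C x)"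
  using koszul_exact_num1[of "\<lambda>i x. T x - w $ i *\<^sub>C x"] bounded_clinear_diff_scaleC[OF assms]
  by (simp add: taylor_spectrum_def)

lemma taylor_spectrum_num1_subset:
  assumes "bounded_clinear T"
  shows "taylor_spectrum (\<lambda>_::1. T) \<subseteq> vec ` Y \<longleftrightarrow>
    (\<forall>z. \<not> bij (\<lambda>x. T x - z *\<^sub>C x) \<longrightarrow> z \<in> Y)"
proof -
  have vec: "w \<in> vec ` Y \<longleftrightarrow> w $ 1 \<in> Y" for w :: "complex ^ 1"
  proof -
    have "w = vec (w $ 1)" by (simp add: vec_eq_iff)
    then show ?thesis by (metis image_iff vec_component)
  qed
  show ?thesis
    unfolding subset_iff vec taylor_spectrum_num1[OF assms] by (metis vec_component)
qed

definition kappa_scale :: "real \<Rightarrow> complex" where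
  "kappa_scale r = complex_of_real (sqrt (1 + r\<^sup>2))"

lemma kappa_scale_nonzero: "kappa_scale r \<noteq> 0"
  by (simp add: kappa_scale_def add_nonneg_eq_0_iff)

lemma kappa_component: "kappa r z $ 1 = z / kappa_scale r" "kappa r z $ 2 = r / (kappa_scale r * z)"
  by (simp_all add: kappa_def kappa_scale_def divide_simps)

lemma kappa_op_component:
  "kappa_op r T 1 = (\<lambda>x. inverse (kappa_scale r) *\<^sub>C T x)"
  "kappa_op r T 2 = (\<lambda>x. (r / kappa_scale r) *\<^sub>C inv T x)"
  by (simp_all add: kappa_op_def kappa_scale_def scaleR_scaleC divide_simps)

context
  fixes r :: real and T :: "'a::complex_inner \<Rightarrow> 'a"
  assumes T: "invertible_op T" and r: "r \<noteq> 0"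
begin

lemma bounded_clinear_kappa_op: "bounded_clinear (kappa_op r T i)"
proof (cases "i = 1")
  case False
  then have "i = 2" by (metis exhaust_2)
  then show ?thesis
    by (simp add: kappa_op_component bounded_clinear_scaleC_left invertible_op_inv[OF T])
qed (simp add: kappa_op_component bounded_clinear_scaleC_left invertible_op_inv[OF T])

lemma kappa_op_1_2: "kappa_op r T 1 (kappa_op r T 2 x) = kappa_op r T 2 (kappa_op r T 1 x)"
  by (simp add: kappa_op_component invertible_op_inv[OF T] bounded_clinear_scaleC mult.commute)

lemma commuting_tuple_kappa_op: "commuting_tuple (kappa_op r T)"
proof -
  have "kappa_op r T i \<circ> kappa_op r T j = kappa_op r T j \<circ> kappa_op r T i" for i j
    using exhaust_2[of i] exhaust_2[of j] kappa_op_1_2 by (auto simp: fun_eq_iff)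
  then show ?thesis by (simp add: commuting_tuple_def bounded_clinear_kappa_op)
qed

text \<open>A spectral mapping property, checked point by point: off the curve
  \<open>w $ 1 * w $ 2 = r / (kappa_scale r)\<^sup>2\<close> the complex is always exact; on it w =
  \<kappa>(z), and exactness is bijectivity of T - z.\<close>

lemma taylor_spectrum_kappa_op:
  "taylor_spectrum (kappa_op r T) = kappa r ` {z. \<not> bij (\<lambda>x. T x - z *\<^sub>C x)}"
proof -
  note lin = bounded_clinear_linear[OF bounded_clinear_kappa_op]
    bounded_clinear_diff_scaleC[OF bounded_clinear_kappa_op]
  note inv = invertible_op_inv[OF T]
  have z0: "z \<noteq> 0" if "\<not> bij (\<lambda>x. T x - z *\<^sub>C x)" for z
    using that inv(5) by auto
  define D where "D w i x = kappa_op r T i x - w $ i *\<^sub>C x" for w :: "complex ^ 2" and i x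
  have D_lin: "linear (D w i)" for w i
    using lin(2)[of i "w $ i"] by (simp add: D_def[abs_def])
  have D_comm: "D w 1 (D w 2 x) = D w 2 (D w 1 x)" for w x
    by (simp add: D_def kappa_op_1_2 linear_diff[OF lin(1)] cvs.scale_right_diff_distrib
        bounded_clinear_scaleC[OF bounded_clinear_kappa_op] mult.commute)
  have spec: "w \<in> taylor_spectrum (kappa_op r T) \<longleftrightarrow> \<not> koszul_exact (D w)" for w
    by (simp add: taylor_spectrum_def D_def[abs_def])
  have off: "koszul_exact (D w)" if c: "c = r / (kappa_scale r)\<^sup>2 - w $ 1 * w $ 2" "c \<noteq> 0" for w c
  proof -
    \<comment> \<open>For (A, B) = \<kappa>(T) the identity B(A - w_1) + w_1(B - w_2) = BA - w_1 w_2
      = c, divided by \<open>c\<close>, gives U_1 = B/c and U_2 = w_1/c.\<close>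
    define U where "U i x = (if i = 1 then (r / (kappa_scale r * c)) *\<^sub>C inv T x else (w $ 1 / c) *\<^sub>C x)"
      for i :: 2 and x
    show ?thesis
    proof (rule koszul_exact_2I[where U = U])
      show "linear (U i)" for i
        by (rule linearI) (simp_all add: U_def cvs.scale_right_distrib scaleR_scaleC mult.commute
            linear_add[OF bounded_clinear_linear[OF inv(2)]] bounded_clinear_scaleC[OF inv(2)])
      show "U i (D w j x) = D w j (U i x)" for i j x
        using exhaust_2[of j]
        by (auto simp: U_def D_def kappa_op_component inv cvs.scale_right_diff_distrib mult_ac
            linear_diff[OF bounded_clinear_linear[OF inv(1)]] bounded_clinear_scaleC[OF inv(1)]
            linear_diff[OF bounded_clinear_linear[OF inv(2)]] bounded_clinear_scaleC[OF inv(2)])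
      show "U 1 (D w 1 x) + U 2 (D w 2 x) = x" for x
      proof -
        have "U 1 (D w 1 x) + U 2 (D w 2 x) =
            (r / (kappa_scale r * c) / kappa_scale r) *\<^sub>C x - (w $ 1 / c * w $ 2) *\<^sub>C x"
          by (simp add: U_def D_def kappa_op_component inv cvs.scale_right_diff_distrib mult_ac
            linear_diff[OF bounded_clinear_linear[OF inv(2)]] bounded_clinear_scaleC[OF inv(2)])
            (simp add: field_simps)
        also have "\<dots> = ((r / (kappa_scale r)\<^sup>2 - w $ 1 * w $ 2) / c) *\<^sub>C x"
          by (simp add: cvs.scale_left_diff_distrib diff_divide_distrib power2_eq_square mult_ac)
        also have "\<dots> = x" using c by simp
        finally show ?thesis .
      qed
    qed (fact D_lin D_comm)+
  qed
  \<comment> \<open>The source is 1/T - 1/z = -(1/z) T^(-1) (T - z). The factor on the left serves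
    for kernels, the factor on the right for ranges.\<close>
  have D2: "D (kappa r z) 2 x = - (r / z) *\<^sub>C inv T (D (kappa r z) 1 x)"
    "D (kappa r z) 2 x = D (kappa r z) 1 (- (r / z) *\<^sub>C inv T x)" if "z \<noteq> 0" for z :: complex and x
    using that kappa_scale_nonzero
    by (simp_all add: D_def kappa_component kappa_op_component inv cvs.scale_right_diff_distrib
        linear_diff[OF bounded_clinear_linear[OF inv(2)]] bounded_clinear_scaleC[OF inv(2)]
        bounded_clinear_scaleC[OF inv(1)]
        linear_neg[OF bounded_clinear_linear[OF inv(1)]] divide_simps)
  have on: "koszul_exact (D (kappa r z)) \<longleftrightarrow> bij (D (kappa r z) 1)" if z: "z \<noteq> 0" for z
  proof
    let ?D = "D (kappa r z)"
    assume ex: "koszul_exact ?D"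
    have "h = 0" if "?D 1 h = 0" for h
      using koszul_exact_2_imp(1)[OF ex D_lin that] D2(1)[OF z, of h] that
        linear_0[OF bounded_clinear_linear[OF inv(2)]] by simp
    \<comment> \<open>Top-degree exactness writes \<open>y\<close> as a difference of values of
      \<open>?D 2\<close> and \<open>?D 1\<close>; the range of \<open>?D 2\<close> lies in that of
      \<open>?D 1\<close>.\<close>
    moreover have "\<exists>x. y = ?D 1 x" for y
      using koszul_exact_2_imp(2)[OF ex D_lin, of y] linear_diff[OF D_lin, symmetric]
      unfolding D2(2)[OF z] by metis
    ultimately show "bij (?D 1)"
      unfolding bij_def linear_injective_0[OF D_lin] surj_def by blast
  next
    let ?D = "D (kappa r z)"
    assume b: "bij (?D 1)"
    \<comment> \<open>The inverse of \<open>?D 1\<close> alone gives the homotopy; it commutes with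
      the pair because \<open>?D 1\<close> does.\<close>
    define U where "U i = (if i = 1 then inv (?D 1) else (\<lambda>x. 0))" for i :: 2
    have comm: "?D j (?D 1 x) = ?D 1 (?D j x)" for j x
      using exhaust_2[of j] D_comm by auto
    show "koszul_exact ?D"
    proof (rule koszul_exact_2I[where U = U])
      show "linear (U i)" for i
        by (rule linearI) (use b in \<open>auto simp: U_def linear_add[OF D_lin] linear_scale[OF D_lin]
            bij_is_surj surj_f_inv_f intro!: inv_f_eq[OF bij_is_inj]\<close>)
      show "U i (?D j x) = ?D j (U i x)" for i j x
        using comm[of j "inv (?D 1) x"] b
        by (auto simp: U_def linear_0[OF D_lin] bij_is_surj surj_f_inv_f bij_is_inj inv_f_eq)
      show "U 1 (?D 1 x) + U 2 (?D 2 x) = x" for x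
        using b by (simp add: U_def bij_is_inj)
    qed (fact D_lin D_comm)+
  qed
  have D1: "bij (D (kappa r z) 1) \<longleftrightarrow> bij (\<lambda>x. T x - z *\<^sub>C x)" for z
  proof -
    have "D (kappa r z) 1 = (\<lambda>x. inverse (kappa_scale r) *\<^sub>C (T x - z *\<^sub>C x))"
      by (simp add: fun_eq_iff D_def kappa_component kappa_op_component
          cvs.scale_right_diff_distrib divide_inverse mult.commute)
    then show ?thesis using kappa_scale_nonzero by (simp add: bij_scaleC_iff)
  qed
  have image: "\<exists>z. z \<noteq> 0 \<and> w = kappa r z" if "w $ 1 * w $ 2 = r / (kappa_scale r)\<^sup>2" for w
  proof (intro exI conjI)
    \<comment> \<open>The product of the coordinates of \<open>w\<close> is nonzero because
      \<open>r\<close> is, so \<open>w $ 1\<close> cannot vanish.\<close>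
    show "kappa_scale r * w $ 1 \<noteq> 0" using that r kappa_scale_nonzero by auto
    then show "w = kappa r (kappa_scale r * w $ 1)"
      using that kappa_scale_nonzero
      by (simp add: vec_eq_iff forall_2 kappa_component field_simps power2_eq_square)
  qed
  have "w \<in> taylor_spectrum (kappa_op r T) \<longleftrightarrow> (\<exists>z. w = kappa r z \<and> \<not> bij (\<lambda>x. T x - z *\<^sub>C x))" for w
  proof
    assume "w \<in> taylor_spectrum (kappa_op r T)"
    then have ne: "\<not> koszul_exact (D w)" by (simp add: spec)
    then have "w $ 1 * w $ 2 = r / (kappa_scale r)\<^sup>2" using off[OF refl, of w] by (metis right_minus_eq)
    then obtain z where "z \<noteq> 0" "w = kappa r z" using image by blast
    with ne on D1 show "\<exists>z. w = kappa r z \<and> \<not> bij (\<lambda>x. T x - z *\<^sub>C x)" by blast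
  next
    assume "\<exists>z. w = kappa r z \<and> \<not> bij (\<lambda>x. T x - z *\<^sub>C x)"
    then show "w \<in> taylor_spectrum (kappa_op r T)" using z0 on D1 spec by blast
  qed
  then show ?thesis by blast
qed

lemma taylor_spectrum_kappa_op_subset:
  assumes "Y \<subseteq> - {0}"
  shows "taylor_spectrum (kappa_op r T) \<subseteq> kappa r ` Y \<longleftrightarrow>
    (\<forall>z. \<not> bij (\<lambda>x. T x - z *\<^sub>C x) \<longrightarrow> z \<in> Y)"
proof -
  have "inj (kappa r)"
  proof (rule injI)
    fix z w assume "kappa r z = kappa r w"
    then have "kappa r z $ 1 = kappa r w $ 1" by simp
    then show "z = w" using kappa_scale_nonzero by (simp add: kappa_component)
  qed
  then show ?thesis by (auto simp: taylor_spectrum_kappa_op inj_image_subset_iff)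
qed

end


section \<open>Pulling rational functions back along $\kappa$\<close>

text \<open>
  The polynomial $z^N p(\kappa(z))$, if \<open>N\<close> is at least the degree of \<open>p\<close> in the second variable;
  otherwise the subtraction of exponents is truncated.
\<close>

definition kappa_pullback :: "real \<Rightarrow> nat \<Rightarrow> ((2 \<Rightarrow>\<^sub>0 nat) \<Rightarrow>\<^sub>0 complex) \<Rightarrow> complex poly" where
  "kappa_pullback r N p = (\<Sum>m\<in>Poly_Mapping.keys p.
     monom (Poly_Mapping.lookup p m * (inverse (kappa_scale r) ^ Poly_Mapping.lookup m 1 * (r / kappa_scale r) ^ Poly_Mapping.lookup m 2))
       (N + Poly_Mapping.lookup m 1 - Poly_Mapping.lookup m 2))"

lemma poly_kappa_pullback:
  assumes "z \<noteq> 0" and N: "\<And>m. m \<in> Poly_Mapping.keys p \<Longrightarrow> Poly_Mapping.lookup m 2 \<le> N"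
  shows "poly (kappa_pullback r N p) z = z ^ N * mpoly_eval p (kappa r z)"
  unfolding kappa_pullback_def mpoly_eval_def poly_sum sum_distrib_left poly_monom
proof (rule sum.cong)
  fix m assume "m \<in> Poly_Mapping.keys p"
  let ?a = "Poly_Mapping.lookup m 1" and ?b = "Poly_Mapping.lookup m 2"
  have "z ^ (N + ?a - ?b) = z ^ N * z ^ ?a / z ^ ?b"
    using N[OF \<open>m \<in> _\<close>] assms(1) by (simp add: power_diff power_add)
  then show "Poly_Mapping.lookup p m * (inverse (kappa_scale r) ^ ?a * (r / kappa_scale r) ^ ?b) * z ^ (N + ?a - ?b) =
      z ^ N * (Poly_Mapping.lookup p m * (\<Prod>i\<in>UNIV. kappa r z $ i ^ Poly_Mapping.lookup m i))"
    by (simp add: UNIV_2 kappa_component power_divide power_mult_distrib power_inverse divide_inverse)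
qed simp

lemma funpow_left_inverse:
  assumes "\<And>x. S (T x) = x"
  shows "(S ^^ b) ((T ^^ (b + k)) x) = (T ^^ k) x"
  by (induction b) (simp_all add: assms funpow_swap1[of S])

text \<open>T^N acts first and absorbs the negative powers: with exponents a and b of a monomial,
  T^(N+a) splits off T^b, which the b copies of T^(-1) cancel.\<close>

lemma poly_op_kappa_pullback:
  assumes T: "invertible_op T"
    and N: "\<And>m. m \<in> Poly_Mapping.keys p \<Longrightarrow> Poly_Mapping.lookup m 2 \<le> N"
  shows "poly_op (kappa_pullback r N p) T = mpoly_op p (kappa_op r T) \<circ> (T ^^ N)"
proof
  fix x
  note inv = invertible_op_inv[OF T]
  have "monomial_op m (kappa_op r T) ((T ^^ N) x) =
      (inverse (kappa_scale r) ^ Poly_Mapping.lookup m 1 * (r / kappa_scale r) ^ Poly_Mapping.lookup m 2) *\<^sub>C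
      (T ^^ (N + Poly_Mapping.lookup m 1 - Poly_Mapping.lookup m 2)) x"
    if "m \<in> Poly_Mapping.keys p" for m
  proof -
    let ?a = "Poly_Mapping.lookup m 1" and ?b = "Poly_Mapping.lookup m 2"
    have pow: "(T ^^ ?a) ((T ^^ N) x) = (T ^^ (?b + (N + ?a - ?b))) x"
      using N[OF that] by (simp add: add.commute flip: comp_apply[of "T ^^ _" "T ^^ _"] funpow_add)
    have "((inv T) ^^ n) (c *\<^sub>C y) = c *\<^sub>C ((inv T) ^^ n) y" for n c y
      by (induction n) (simp_all add: bounded_clinear_scaleC[OF inv(2)])
    then show ?thesis
      by (simp only: monomial_op_2 kappa_op_component comp_apply funpow_scaleC[OF inv(1)]
          funpow_scaleC[OF inv(2)] pow funpow_left_inverse[of "inv T" T, OF inv(4)] cvs.scale_scale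
          mult.commute)
  qed
  then show "poly_op (kappa_pullback r N p) T x = (mpoly_op p (kappa_op r T) \<circ> (T ^^ N)) x"
    by (simp add: kappa_pullback_def mpoly_op_def poly_op_sum[OF inv(1)] poly_op_monom[OF inv(1)])
qed


section \<open>Von Neumann sets\<close>

text \<open>The supremum over the empty set is 0, so the constant function 1 forces the identity to
  have norm 0. Conversely, on the zero space every norm is 0 and every Koszul complex is
  exact.\<close>

lemma von_neumann_set_empty:
  fixes T :: "'n::{finite,linorder} \<Rightarrow> 'a::chilbert_space \<Rightarrow> 'a"
  shows "von_neumann_set {} T \<longleftrightarrow> commuting_tuple T \<and> (\<forall>x :: 'a. x = 0)"
proof
  assume vn: "von_neumann_set {} T"
  define e :: "('n \<Rightarrow>\<^sub>0 nat) \<Rightarrow>\<^sub>0 complex" where "e = Poly_Mapping.single 0 1"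
  have e: "mpoly_op e T = id"
  proof
    fix x
    have "foldr (\<lambda>i F. (T i ^^ Poly_Mapping.lookup 0 i) \<circ> F) xs id = id" for xs
      by (induction xs) auto
    then show "mpoly_op e T x = id x" by (simp add: mpoly_op_def e_def monomial_op_def)
  qed
  have "(e, e) \<in> Rat {}" by (simp add: Rat_def e_def)
  with vn have "ennreal (onorm (rat_op e e T)) \<le> 0"
    by (auto simp: von_neumann_set_def bot_ennreal)
  then have "onorm (id :: 'a \<Rightarrow> 'a) \<le> 0" by (simp add: rat_op_def e inv_id ennreal_eq_0_iff)
  then have "norm x \<le> 0" for x :: 'a
    using onorm[OF bounded_linear_ident, of x] mult_right_mono[of _ 0 "norm x"]
    unfolding id_def by (metis mult_zero_left norm_ge_zero order_trans)
  with vn show "commuting_tuple T \<and> (\<forall>x :: 'a. x = 0)" by (simp add: von_neumann_set_def)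
next
  assume *: "commuting_tuple T \<and> (\<forall>x :: 'a. x = 0)"
  then have all: "x = y" for x y :: 'a by metis
  have feq: "f = g" for f g :: "'b \<Rightarrow> 'a" using all by blast
  have "onorm f = 0" for f :: "'a \<Rightarrow> 'a"
    by (subst feq[of f "\<lambda>_. 0"]) (rule onorm_zero)
  moreover have "koszul_exact S" for S :: "'n \<Rightarrow> 'a \<Rightarrow> 'a"
    unfolding koszul_exact_def using feq by blast
  ultimately show "von_neumann_set {} T"
    using * by (auto simp: von_neumann_set_def taylor_spectrum_def)
qed

theorem theorem5p13:
  fixes r :: real and T :: "'a::chilbert_space \<Rightarrow> 'a" and Y :: "complex set"
  assumes "0 < r" and "r < 1"
    and "invertible_op T"
    and "Y \<subseteq> - {0}"
  shows "von_neumann_set ((vec :: complex \<Rightarrow> complex ^ 1) ` Y) (\<lambda>_::1. T) \<longleftrightarrow>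
         von_neumann_set (kappa r ` Y) (kappa_op r T)"
proof -
  let ?V = "(vec :: complex \<Rightarrow> complex ^ 1) ` Y"
  have r: "r \<noteq> 0" using assms by simp
  note inv = invertible_op_inv[OF assms(3)]
  have comm: "commuting_tuple (\<lambda>_::1. T)" "commuting_tuple (kappa_op r T)"
    using inv(1) commuting_tuple_kappa_op[OF assms(3) r] by (simp_all add: commuting_tuple_def)
  define s where "s = kappa_scale r"
  have s: "s \<noteq> 0" unfolding s_def by (rule kappa_scale_nonzero)
  \<comment> \<open>The empty set is treated apart: a nonzero denominator may vanish on the whole
    curve \<kappa>(z), and only a point of \<open>Y\<close> ensures that its pullback is
    nonzero.\<close>
  show ?thesis
  proof (cases "Y = {}")
    case True
    then show ?thesis using comm by (simp add: von_neumann_set_empty)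
  next
    case False
    then obtain y where y: "y \<in> Y" by blast
    have spec: "taylor_spectrum (\<lambda>_::1. T) \<subseteq> ?V \<longleftrightarrow> taylor_spectrum (kappa_op r T) \<subseteq> kappa r ` Y"
      using taylor_spectrum_num1_subset[OF inv(1)]
        taylor_spectrum_kappa_op_subset[OF assms(3) r assms(4)] by metis
    show ?thesis
    proof
      assume vn: "von_neumann_set ?V (\<lambda>_::1. T)"
      then have sub: "taylor_spectrum (\<lambda>_::1. T) \<subseteq> ?V" by (simp add: von_neumann_set_def)
      then have bij: "bij (\<lambda>x. T x - z *\<^sub>C x)" if "z \<notin> Y" for z
        using that taylor_spectrum_num1_subset[OF inv(1)] by metis
      have "ennreal (onorm (rat_op p g (kappa_op r T))) \<le>
          (SUP z\<in>kappa r ` Y. ennreal (cmod (mpoly_eval p z / mpoly_eval g z)))"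
        if "(p, g) \<in> Rat (kappa r ` Y)" for p g
      proof -
        \<comment> \<open>A crude bound for both degrees in the second variable; a common
          \<open>N\<close> makes the factors z^N cancel in the quotient.\<close>
        define N where "N = (\<Sum>m\<in>Poly_Mapping.keys p \<union> Poly_Mapping.keys g. Poly_Mapping.lookup m 2)"
        have N: "Poly_Mapping.lookup m 2 \<le> N" if "m \<in> Poly_Mapping.keys p \<union> Poly_Mapping.keys g" for m
          unfolding N_def by (rule member_le_sum) (use that in auto)
        let ?P = "kappa_pullback r N p" and ?G = "kappa_pullback r N g"
        have P: "poly ?P z = z ^ N * mpoly_eval p (kappa r z)"
          and G: "poly ?G z = z ^ N * mpoly_eval g (kappa r z)" if "z \<in> Y" for z
          using that assms(4) N by (auto intro!: poly_kappa_pullback)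
        have G0: "poly ?G z \<noteq> 0" if "z \<in> Y" for z
          using G[OF that] that \<open>(p, g) \<in> _\<close> assms(4) by (auto simp: Rat_def)
        then have Gn: "?G \<noteq> 0" using y by force
        \<comment> \<open>Roots of \<open>?G\<close> lie outside \<open>Y\<close>, where T - z is
          bijective because the spectrum is contained in \<open>Y\<close>.\<close>
        have Gb: "bij (poly_op ?G T)"
          using bij_poly_op[OF inv(1) Gn] G0 bij by blast
        let ?p = "of_poly (1::1) 1 ?P" and ?g = "of_poly (1::1) 1 ?G"
        have pg: "mpoly_op ?p (\<lambda>_. T) = poly_op ?P T" "mpoly_op ?g (\<lambda>_. T) = poly_op ?G T"
          using mpoly_op_of_poly[of "\<lambda>_. T" "1::1" 1] inv(1) by simp_all
        have bT: "bij (T ^^ N)" using inv(5) by (rule bij_betw_funpow)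
        have "poly_op ?G T = mpoly_op g (kappa_op r T) \<circ> (T ^^ N)"
          using N by (intro poly_op_kappa_pullback[OF assms(3)]) auto
        then have "mpoly_op g (kappa_op r T) = poly_op ?G T \<circ> inv (T ^^ N)"
          using bij_is_surj[OF bT, unfolded surj_iff] by (simp add: comp_assoc)
        \<comment> \<open>Both factors are bijective, so \<open>inv\<close> reverses the
          composition; the resulting T^N is then absorbed by the numerator
          \<open>?P\<close>.\<close>
        then have "inv (mpoly_op g (kappa_op r T)) = (T ^^ N) \<circ> inv (poly_op ?G T)"
          using o_inv_distrib[OF Gb bij_imp_bij_inv[OF bT]] by (simp add: inv_inv_eq[OF bT])
        moreover have "poly_op ?P T = mpoly_op p (kappa_op r T) \<circ> (T ^^ N)"
          using N by (intro poly_op_kappa_pullback[OF assms(3)]) auto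
        ultimately have rat: "rat_op p g (kappa_op r T) = rat_op ?p ?g (\<lambda>_. T)"
          by (simp add: rat_op_def pg comp_assoc)
        have "?g \<noteq> 0"
          using G0[OF y] mpoly_eval_of_poly[of "1::1" 1 ?G "vec y"] by (auto simp: mpoly_eval_def)
        then have "(?p, ?g) \<in> Rat ?V"
          using G0 by (auto simp: Rat_def mpoly_eval_of_poly)
        then have "ennreal (onorm (rat_op ?p ?g (\<lambda>_. T))) \<le>
            (SUP z\<in>?V. ennreal (cmod (mpoly_eval ?p z / mpoly_eval ?g z)))"
          using vn by (auto simp: von_neumann_set_def)
        also have "\<dots> = (SUP z\<in>Y. ennreal (cmod (mpoly_eval p (kappa r z) / mpoly_eval g (kappa r z))))"
          unfolding image_image
        proof (rule SUP_cong)
          fix z assume z: "z \<in> Y"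
          then have "z \<noteq> 0" using assms(4) by auto
          then show "ennreal (cmod (mpoly_eval ?p (vec z) / mpoly_eval ?g (vec z))) =
              ennreal (cmod (mpoly_eval p (kappa r z) / mpoly_eval g (kappa r z)))"
            by (simp add: mpoly_eval_of_poly P[OF z] G[OF z])
        qed simp
        finally show ?thesis by (simp add: rat image_image)
      qed
      then show "von_neumann_set (kappa r ` Y) (kappa_op r T)"
        using comm(2) sub spec by (auto simp: von_neumann_set_def)
    next
      assume vn: "von_neumann_set (kappa r ` Y) (kappa_op r T)"
      then have sub: "taylor_spectrum (kappa_op r T) \<subseteq> kappa r ` Y" by (simp add: von_neumann_set_def)
      have "ennreal (onorm (rat_op p g (\<lambda>_::1. T))) \<le>
          (SUP z\<in>?V. ennreal (cmod (mpoly_eval p z / mpoly_eval g z)))"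
        if "(p, g) \<in> Rat ?V" for p g
      proof -
        \<comment> \<open>Substituting s w_1 for the variable inverts \<kappa>, and s times the
          first operator of \<kappa>(T) is T. Numerators and denominators thus agree separately, on
          points and on operators.\<close>
        define lift where "lift q = of_poly (1::2) s (to_poly q)" for q
        have T: "(\<lambda>x. s *\<^sub>C kappa_op r T 1 x) = T"
          using s by (simp add: fun_eq_iff kappa_op_component s_def)
        have op: "mpoly_op (lift q) (kappa_op r T) = mpoly_op q (\<lambda>_. T)" for q
          unfolding lift_def
          using mpoly_op_of_poly[of "kappa_op r T" "1::2" s] inv(1)
            bounded_clinear_kappa_op[OF assms(3) r] poly_op_to_poly[OF inv(1)] by (simp add: T)
        have ev: "mpoly_eval (lift q) (kappa r z) = mpoly_eval q (vec z)" for q z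
          using s by (simp add: lift_def mpoly_eval_of_poly kappa_component poly_to_poly flip: s_def)
        have "mpoly_eval (lift g) (kappa r z) \<noteq> 0" if "z \<in> Y" for z
          using that \<open>(p, g) \<in> _\<close> by (auto simp: ev Rat_def)
        moreover from this[OF y] have "lift g \<noteq> 0" by (auto simp: mpoly_eval_def)
        ultimately have "(lift p, lift g) \<in> Rat (kappa r ` Y)"
          by (auto simp: Rat_def)
        then have "ennreal (onorm (rat_op (lift p) (lift g) (kappa_op r T))) \<le>
            (SUP z\<in>kappa r ` Y. ennreal (cmod (mpoly_eval (lift p) z / mpoly_eval (lift g) z)))"
          using vn by (auto simp: von_neumann_set_def)
        then show ?thesis by (simp add: rat_op_def op image_image ev)
      qed
      then show "von_neumann_set ?V (\<lambda>_::1. T)"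
        using comm(1) sub spec by (auto simp: von_neumann_set_def)
    qed
  qed
qed

end
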